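(* Let $x\in\mathcal M$ and $t>0$. Suppose $\bar B_x$ has full column rank and $\mathcal B_x$ is symmetric positive definite over $\mathfrak L_x=\{w\in\mathbb R^j:\bar B_x^Tw=0\}$. Then the solution $u(x)$ of the proximal Newton equation $J(x)[u(x)]=-v(x)$ is given by $$u(x)=\begin{pmatrix}\bar v(x)+w(x)\\ \hat v(x)\end{pmatrix},\qquad w(x)=\arg\min_{\bar B_x^Tw=0}\ \ell_{x,t}^Tw+\tfrac12w^T\mathcal B_xw .$$
   Context: Setting. $\mathcal M\subset\mathbb R^n$ is a compact embedded submanifold with the induced Riemannian metric; $c=n-\dim\mathcal M$; $T_x\mathcal M$, $N_x\mathcal M$ are tangent and normal spaces; $P_L$ is the orthogonal projection onto a subspace $L$. $h(x)=\mu\|x\|_1$, $\mu>0$; $f:\mathbb R^n\to\mathbb R$ is twice continuously differentiable with Euclidean gradient $\nabla f$ and Hessian $\nabla^2f$. $B_x\in\mathbb R^{n\times c}$ has as columns an orthonormal basis of $N_x\mathcal M$, so $T_x\mathcal M=\{v:B_x^Tv=0\}$. The Weingarten map is $\mathcal W_x(w,u)=(\mathrm D(y\mapsto P_{T_y\mathcal M})(x)[w])u$ for $w\in T_x\mathcal M$, $u\in N_x\mathcal M$. Proximal gradient direction: $v(x)=\arg\min_{v\in T_x\mathcal M} f(x)+\langle\nabla f(x),v\rangle+\frac1{2t}\|v\|_F^2+h(x+v)$, and $\lambda(x)\in\mathbb R^{c}$ is a Lagrange multiplier, i.e. $v(x)=\mathrm{prox}_{th}(x-t[\nabla f(x)+B_x\lambda(x)])-x$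 with $\mathrm{prox}_{th}(z)=\max(|z|-t\mu,0)\odot\mathrm{sign}(z)$ and $B_x^Tv(x)=0$. Partition: let $j$ be the number of nonzero entries of $x+v(x)$; order coordinates so these are the first $j$. For a vector or matrix $A$ with $n$ rows, $\bar A$ is its first $j$ rows and $\hat A$ its last $n-j$ rows. $\mathcal L_x(\cdot)=\mathcal W_x(\cdot,B_x\lambda(x))$, regarded as a symmetric operator on $\mathbb R^n$ by precomposition with $P_{T_x\mathcal M}$; $\mathfrak B_x=\nabla^2f(x)-\mathcal L_x=\begin{pmatrix}\mathcal B_x&\mathfrak B_x^{(12)}\\ \mathfrak B_x^{(21)}&\mathfrak B_x^{(22)}\end{pmatrix}$ with $\mathcal B_x\in\mathbb R^{j\times j}$. $\ell_{x,t}=\frac1t(-I_j+t\mathcal B_x)\bar v(x)+\mathfrak B_x^{(12)}\hat v(x)$. Newton operator: $M_x=\mathrm{diag}(I_j,0_{n-j})$ (equivalently $(M_x)_{ii}=0$ iff $|x-t[\nabla f(x)+B_x\lambda(x)]|_i\le t\mu$), $\Lambda_x=M_x-M_xB_x(B_x^TM_xB_x)^{-1}B_x^TM_x$, and $J(x)=-[I_n-\Lambda_x+t\Lambda_x(\nabla^2f(x)-\mathcal L_x)]$. *)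

theory Defs
  imports "HOL-Analysis.Analysis"
begin

section \<open>Embedded submanifolds of Euclidean space\<close>

text \<open>\<open>Ck_on k U f\<close>: all iterated directional derivatives of \<open>f\<close> up to order \<open>k\<close> exist and are
  continuous on the open set \<open>U\<close>.\<close>

primrec Ck_on :: "nat \<Rightarrow> 'a::real_normed_vector set \<Rightarrow> ('a \<Rightarrow> 'b::real_normed_vector) \<Rightarrow> bool" where
  "Ck_on 0 U f \<longleftrightarrow> continuous_on U f"
| "Ck_on (Suc k) U f \<longleftrightarrow>
     (\<forall>x\<in>U. f differentiable (at x)) \<and> (\<forall>v. Ck_on k U (\<lambda>x. frechet_derivative f (at x) v))"

definition smooth_on :: "'a::real_normed_vector set \<Rightarrow> ('a \<Rightarrow> 'b::real_normed_vector) \<Rightarrow> bool" where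
  "smooth_on U f \<longleftrightarrow> (\<forall>k. Ck_on k U f)"

text \<open>Submanifold of dimension \<open>d\<close>, by slice charts: near each of its points \<open>M\<close> is carried onto an
  open piece of a \<open>d\<close>-dimensional linear subspace by a smooth diffeomorphism of open sets of the
  ambient space.\<close>

definition embedded_submanifold :: "nat \<Rightarrow> 'a::euclidean_space set \<Rightarrow> bool" where
  "embedded_submanifold d M \<longleftrightarrow>
     (\<forall>x\<in>M. \<exists>U V \<phi> \<psi> E. open U \<and> x \<in> U \<and> open V \<and> homeomorphism U V \<phi> \<psi> \<and>
        smooth_on U \<phi> \<and> smooth_on V \<psi> \<and>
        subspace E \<and> dim E = d \<and> \<phi> ` (M \<inter> U) = V \<inter> (E :: 'a set))"

definition tangent_space_at :: "'a::euclidean_space set \<Rightarrow> 'a \<Rightarrow> 'a set" where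
  "tangent_space_at M x =
     {w. \<exists>e>0. \<exists>\<gamma> :: real \<Rightarrow> 'a. smooth_on {-e<..<e} \<gamma> \<and> \<gamma> ` {-e<..<e} \<subseteq> M \<and>
           \<gamma> 0 = x \<and> (\<gamma> has_vector_derivative w) (at 0)}"

definition normal_space_at :: "'a::euclidean_space set \<Rightarrow> 'a \<Rightarrow> 'a set" where
  "normal_space_at M x = (tangent_space_at M x)\<^sup>\<bottom>"

text \<open>The matrix of the orthogonal projection onto the linear subspace \<open>L\<close>.\<close>

definition orth_proj :: "(real^'n) set \<Rightarrow> real^'n^'n" where
  "orth_proj L = matrix (closest_point L)"

text \<open>The map \<open>y \<mapsto> orth_proj (tangent_space_at M y)\<close> lives on \<open>M\<close> only, so its differential is the
  derivative within \<open>M\<close>. On a submanifold that derivative is determined exactly on the tangent space;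
  \<open>weingarten M x w u\<close> is therefore meaningful for tangent \<open>w\<close> (and is used only for such \<open>w\<close>).\<close>

definition weingarten :: "(real^'n) set \<Rightarrow> real^'n \<Rightarrow> real^'n \<Rightarrow> real^'n \<Rightarrow> real^'n" where
  "weingarten M x w u =
     frechet_derivative (\<lambda>y. orth_proj (tangent_space_at M y)) (at x within M) w *v u"

definition weingarten_op :: "(real^'n) set \<Rightarrow> real^'n \<Rightarrow> real^'c^'n \<Rightarrow> real^'c \<Rightarrow> real^'n^'n" where
  "weingarten_op M x B lam =
     matrix (\<lambda>w. weingarten M x (orth_proj (tangent_space_at M x) *v w) (B *v lam))"

section \<open>The proximal gradient direction\<close>

definition l1_norm :: "real^'n \<Rightarrow> real" where
  "l1_norm x = (\<Sum>i\<in>UNIV. \<bar>x $ i\<bar>)"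

definition prox_l1 :: "real \<Rightarrow> real \<Rightarrow> real^'n \<Rightarrow> real^'n" where
  "prox_l1 \<mu> t z = (\<chi> i. max (\<bar>z $ i\<bar> - t * \<mu>) 0 * sgn (z $ i))"

definition is_prox_grad_direction ::
  "(real^'n) set \<Rightarrow> (real^'n \<Rightarrow> real) \<Rightarrow> (real^'n \<Rightarrow> real^'n) \<Rightarrow> real \<Rightarrow> real \<Rightarrow> real^'n \<Rightarrow> real^'n \<Rightarrow> bool"
where
  "is_prox_grad_direction M f gradf \<mu> t x v \<longleftrightarrow>
     is_arg_min (\<lambda>v. f x + gradf x \<bullet> v + 1 / (2 * t) * (norm v)\<^sup>2 + \<mu> * l1_norm (x + v))
       (\<lambda>v. v \<in> tangent_space_at M x) v"

section \<open>Blocks\<close>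

text \<open>Instead of reordering the coordinates so that the \<open>j\<close> nonzero entries of \<open>x + v\<close> come first, we
  keep the index set \<open>S\<close> of these entries, \<open>card S = j\<close>. The space \<open>\<real>\<^sup>j\<close> is identified with the
  coordinate subspace \<open>coord_space S\<close>, i.e. blocks are padded by zeros to full size; the overlined
  part of a vector or matrix is its \<open>S\<close>-rows and the hatted part its \<open>- S\<close>-rows. This includes the
  case \<open>j = n\<close>, in which the hatted part is void.\<close>

definition nonzero_coords :: "real^'n \<Rightarrow> 'n set" where
  "nonzero_coords z = {i. z $ i \<noteq> 0}"

definition coord_space :: "'n set \<Rightarrow> (real^'n) set" where
  "coord_space S = {w. \<forall>i. i \<notin> S \<longrightarrow> w $ i = 0}"

text \<open>Used both for vectors (\<open>'a = real\<close>) and for matrices (\<open>'a = real^'c\<close>).\<close>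

definition row_part :: "'n set \<Rightarrow> 'a::zero^'n \<Rightarrow> 'a^'n" where
  "row_part S A = (\<chi> i. if i \<in> S then A $ i else 0)"

definition block :: "'n set \<Rightarrow> 'n set \<Rightarrow> real^'n^'n \<Rightarrow> real^'n^'n" where
  "block I K A = (\<chi> i k. if i \<in> I \<and> k \<in> K then A $ i $ k else 0)"

definition stack :: "'n set \<Rightarrow> real^'n \<Rightarrow> real^'n \<Rightarrow> real^'n" where
  "stack S a b = (\<chi> i. if i \<in> S then a $ i else b $ i)"

text \<open>The subspace \<open>{w \<in> \<real>\<^sup>j. B\<^sup>T w = 0}\<close>, with \<open>B\<close> the overlined part of the normal basis.\<close>

definition reduced_tangent :: "'n set \<Rightarrow> real^'c^'n \<Rightarrow> (real^'n) set" where
  "reduced_tangent S B = {w \<in> coord_space S. transpose (row_part S B) *v w = 0}"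

definition sym_pos_def_over :: "real^'n^'n \<Rightarrow> (real^'n) set \<Rightarrow> bool" where
  "sym_pos_def_over A L \<longleftrightarrow>
     (\<forall>w\<in>L. \<forall>w'\<in>L. w \<bullet> (A *v w') = w' \<bullet> (A *v w)) \<and> (\<forall>w\<in>L. w \<noteq> 0 \<longrightarrow> w \<bullet> (A *v w) > 0)"

text \<open>\<open>ell S t A v\<close> is \<open>\<ell>\<^bsub>x,t\<^esub>\<close>, where \<open>A\<close> is the full matrix \<open>\<nabla>\<^sup>2f(x) - \<L>\<^sub>x\<close>.\<close>

definition ell :: "'n set \<Rightarrow> real \<Rightarrow> real^'n^'n \<Rightarrow> real^'n \<Rightarrow> real^'n" where
  "ell S t A v =
     (1 / t) *\<^sub>R ((- block S S (mat 1) + t *\<^sub>R block S S A) *v row_part S v)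
       + block S (- S) A *v row_part (- S) v"

section \<open>The proximal Newton operator\<close>

definition diag_ind :: "'n set \<Rightarrow> real^'n^'n" where
  "diag_ind S = (\<chi> i k. if i = k \<and> i \<in> S then 1 else 0)"

definition newton_Lambda :: "'n set \<Rightarrow> real^'c^'n \<Rightarrow> real^'n^'n" where
  "newton_Lambda S B =
     (let D = diag_ind S in
      D - D ** B ** matrix_inv (transpose B ** D ** B) ** transpose B ** D)"

definition newton_op :: "'n set \<Rightarrow> real \<Rightarrow> real^'c^'n \<Rightarrow> real^'n^'n \<Rightarrow> real^'n^'n" where
  "newton_op S t B A =
     - (mat 1 - newton_Lambda S B + t *\<^sub>R (newton_Lambda S B ** A))"

lemma nonzero_coords_prox_l1:
  assumes "0 < t" "0 < \<mu>"
  shows "i \<notin> nonzero_coords (prox_l1 \<mu> t z) \<longleftrightarrow> \<bar>z $ i\<bar> \<le> t * \<mu>"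
proof -
  have "0 < t * \<mu>" using assms by simp
  then show ?thesis
    by (auto simp: nonzero_coords_def prox_l1_def max_def sgn_eq_0_iff)
qed

end

theory Submission
  imports Defs
begin

text \<open>If \<open>B\<close> restricted to the rows in \<open>S\<close> has full column rank, then \<open>\<Lambda>\<close> is the orthogonal
  projection onto \<open>L = reduced_tangent S B\<close>. With \<open>w = u - v\<close> the Newton equation therefore reads
  \<open>w = \<Lambda> (w + v - t A (v + w))\<close>, that is, \<open>w \<in> L\<close> and \<open>t A (v + w) - v \<bottom> L\<close>. Divided by \<open>t\<close> and
  restricted to the coordinates in \<open>S\<close>, this is the stationarity condition of the quadratic program.
  Positive definiteness makes the Newton operator injective, hence bijective, which provides the
  minimizer without a separate existence argument.\<close>

text \<open>Expand at \<open>w\<close>: for a step \<open>h\<close> in \<open>L\<close> the linear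
  term vanishes by stationarity and the term \<open>1/2 * (h \<bullet> (A *v h))\<close> is positive
  unless \<open>h = 0\<close>. So \<open>w\<close> is a strict minimizer, which gives existence and
  uniqueness together.\<close>

lemma is_arg_min_quadratic_iff:
  fixes A :: "real^'n^'n"
  assumes L: "subspace L" and A: "sym_pos_def_over A L" and w: "w \<in> L"
    and stationary: "\<And>h. h \<in> L \<Longrightarrow> h \<bullet> (l + A *v w) = 0"
  shows "is_arg_min (\<lambda>w. l \<bullet> w + 1/2 * (w \<bullet> (A *v w))) (\<lambda>w. w \<in> L) w' \<longleftrightarrow> w' = w"
proof -
  define q where "q w = l \<bullet> w + 1/2 * (w \<bullet> (A *v w))" for w
  have less: "q w < q y" if y: "y \<in> L" "y \<noteq> w" for y
  proof -
    define h where "h = y - w"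
    have h: "h \<in> L" "h \<noteq> 0" "y = w + h"
      using y w L by (auto simp: h_def subspace_diff)
    have "w \<bullet> (A *v h) = h \<bullet> (A *v w)" "h \<bullet> (A *v h) > 0"
      using A w h by (auto simp: sym_pos_def_over_def)
    moreover have "q y = q w + h \<bullet> (l + A *v w) + 1/2 * (h \<bullet> (A *v h))"
      using \<open>w \<bullet> (A *v h) = h \<bullet> (A *v w)\<close>
      by (simp add: q_def h matrix_vector_right_distrib inner_simps inner_commute field_simps)
    ultimately show ?thesis
      using stationary[OF h(1)] by simp
  qed
  have "is_arg_min q (\<lambda>w. w \<in> L) w' \<longleftrightarrow> w' = w"
    using less w unfolding is_arg_min_def by (metis less_asym)
  then show ?thesis
    by (simp add: q_def[abs_def])
qed

lemma row_part_matrix_vector_mult: "row_part S C *v y = row_part S (C *v y)"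
  by (simp add: vec_eq_iff row_part_def matrix_vector_mult_def)

lemma diag_ind_mult_vec: "diag_ind S *v z = row_part S z"
proof -
  have "(diag_ind S *v z) $ i = (\<Sum>j\<in>UNIV. if i = j then row_part S z $ i else 0)" for i
    unfolding diag_ind_def matrix_vector_mult_def vec_lambda_beta
    by (rule sum.cong) (auto simp: row_part_def)
  then show ?thesis
    by (simp add: vec_eq_iff)
qed

lemma matrix_vector_mult_minus_left: "(- A) *v x = - (A *v x)" for A :: "real^'n^'m"
  by (metis diff_0 matrix_vector_mult_0 matrix_vector_mult_diff_rdistrib)

text \<open>Truncation to \<open>S\<close> is an orthogonal projection, hence self-adjoint. This
  moves it onto a test vector supported in \<open>S\<close>, where it disappears.\<close>

lemma inner_row_part: "z \<bullet> row_part S y = row_part S z \<bullet> y"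
  by (auto simp: inner_vec_def row_part_def intro!: sum.cong)

lemma row_part_eq_self: "h \<in> coord_space S \<Longrightarrow> row_part S h = h"
  by (auto simp: vec_eq_iff row_part_def coord_space_def)

lemma block_mult_vec: "block S K A *v y = row_part S (A *v row_part K y)"
  by (auto simp: vec_eq_iff row_part_def block_def matrix_vector_mult_def intro!: sum.cong)

text \<open>Up to the factor \<open>t\<close>, \<open>ell\<close> is the \<open>S\<close>-part of
  \<open>t *\<^sub>R (A *v v) - v\<close>: the blocks applied to the two parts of \<open>v\<close>
  add up to the \<open>S\<close>-rows of \<open>A *v v\<close>.\<close>

lemma inner_ell:
  fixes A :: "real^'n^'n"
  assumes h: "h \<in> coord_space S" and "t \<noteq> 0"
  shows "t * (h \<bullet> ell S t A v) = h \<bullet> (t *\<^sub>R (A *v v) - v)"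
proof -
  have "v = row_part S v + row_part (- S) v"
    by (simp add: vec_eq_iff row_part_def)
  then have "A *v v = A *v row_part S v + A *v row_part (- S) v"
    by (metis matrix_vector_right_distrib)
  moreover have "h \<bullet> row_part S z = h \<bullet> z" for z
    using h by (simp add: inner_row_part row_part_eq_self)
  moreover have "row_part S (row_part S z) = row_part S z" for z :: "real^'n" and S
    by (simp add: vec_eq_iff row_part_def)
  ultimately show ?thesis
    using \<open>t \<noteq> 0\<close>
    by (simp add: ell_def matrix_vector_mult_add_rdistrib matrix_vector_mult_diff_rdistrib
        matrix_vector_mult_minus_left
        scaleR_matrix_vector_assoc[symmetric] block_mult_vec inner_simps field_simps)
qed

lemma stack_row_part:
  assumes "w \<in> coord_space S"
  shows "stack S (row_part S v + w) (row_part (- S) v) = v + w"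
  using assms by (auto simp: vec_eq_iff stack_def row_part_def coord_space_def)

lemma subspace_reduced_tangent: "subspace (reduced_tangent S B)"
  by (auto simp: subspace_def reduced_tangent_def coord_space_def
      matrix_vector_right_distrib matrix_vector_mult_scaleR
      simp del: transpose_matrix_vector)

lemma matrix_inv_right: "invertible A \<Longrightarrow> A ** matrix_inv A = mat 1"
  unfolding invertible_def matrix_inv_def by (rule someI2_ex) auto

text \<open>The quadratic form of the Gram matrix at \<open>y\<close> is the squared norm of
  \<open>C *v y\<close>, so its kernel is that of \<open>C\<close>, which is trivial.\<close>

lemma invertible_gram:
  fixes C :: "real^'c^'n"
  assumes "rank C = CARD('c)"
  shows "invertible (transpose C ** C)"
proof -
  have "y = 0" if "(transpose C ** C) *v y = 0" for y
  proof -
    have "(C *v y) \<bullet> (C *v y) = y \<bullet> ((transpose C ** C) *v y)"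
      by (simp add: dot_lmul_matrix[symmetric] matrix_vector_mul_assoc[symmetric]
          vector_transpose_matrix inner_commute)
    then have "C *v y = 0"
      using that by simp
    then show ?thesis
      using assms by (metis full_rank_injective injD matrix_vector_mult_0_right)
  qed
  then show ?thesis
    by (simp add: invertible_left_inverse matrix_left_invertible_ker)
qed

context
  fixes S :: "'n::finite set" and B :: "real^'c^'n"
  assumes full_rank: "rank (row_part S B) = CARD('c)"
begin

text \<open>These are the normal equations: subtracting from \<open>row_part S z\<close> its
  least-squares fit by the columns of \<open>row_part S B\<close> leaves a residual orthogonal to
  these columns.\<close>

lemma newton_Lambda_mult_vec:
  obtains y where "newton_Lambda S B *v z = row_part S z - row_part S B *v y"
    and "transpose (row_part S B) *v (row_part S z - row_part S B *v y) = 0"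
proof
  let ?D = "diag_ind S" and ?C = "row_part S B"
  let ?G = "transpose ?C ** ?C"
  define y where "y = matrix_inv ?G *v (transpose ?C *v z)"
  have C: "?D ** B = ?C"
    by (rule matrix_eq[THEN iffD2])
       (simp add: matrix_vector_mul_assoc[symmetric] diag_ind_mult_vec row_part_matrix_vector_mult)
  have "transpose ?D = ?D"
    by (auto simp: vec_eq_iff transpose_def diag_ind_def)
  have "?D ** ?D = ?D"
    by (rule matrix_eq[THEN iffD2])
       (simp add: matrix_vector_mul_assoc[symmetric] diag_ind_mult_vec, simp add: vec_eq_iff row_part_def)
  have Ct: "transpose B ** ?D = transpose ?C"
    using C \<open>transpose ?D = ?D\<close> by (metis matrix_transpose_mul)
  have "?G = (transpose B ** ?D) ** (?D ** B)"
    by (simp only: Ct C)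
  also have "\<dots> = transpose B ** (?D ** ?D) ** B"
    by (simp only: matrix_mul_assoc)
  finally have G: "transpose B ** ?D ** B = ?G"
    by (simp only: \<open>?D ** ?D = ?D\<close>)
  have "newton_Lambda S B = ?D - ?C ** matrix_inv ?G ** transpose B ** ?D"
    unfolding newton_Lambda_def Let_def G C ..
  also have "\<dots> = ?D - ?C ** matrix_inv ?G ** transpose ?C"
    by (simp only: Ct[symmetric] matrix_mul_assoc)
  finally show "newton_Lambda S B *v z = row_part S z - ?C *v y"
    by (simp add: y_def matrix_vector_mult_diff_rdistrib diag_ind_mult_vec
        matrix_vector_mul_assoc[symmetric])
  \<comment> \<open>\<open>y\<close> is built from \<open>z\<close>, whereas the fit concerns
    \<open>row_part S z\<close>; both give the same right-hand side because \<open>?C\<close> has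
    zero rows outside \<open>S\<close>.\<close>
  have "transpose ?C *v row_part S z = transpose B *v (?D *v (?D *v z))"
    by (simp only: Ct[symmetric] diag_ind_mult_vec[symmetric] matrix_vector_mul_assoc
        matrix_mul_assoc)
  also have "\<dots> = (transpose B ** (?D ** ?D)) *v z"
    by (simp only: matrix_vector_mul_assoc matrix_mul_assoc)
  also have "\<dots> = transpose ?C *v z"
    by (simp only: \<open>?D ** ?D = ?D\<close> Ct)
  finally have z: "transpose ?C *v row_part S z = transpose ?C *v z" .
  have "?G ** matrix_inv ?G = mat 1"
    using invertible_gram[OF full_rank] by (rule matrix_inv_right)
  then have "transpose ?C *v (?C *v y) = transpose ?C *v row_part S z"
    unfolding y_def z by (simp only: matrix_vector_mul_assoc matrix_mul_assoc matrix_mul_lid)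
  then show "transpose ?C *v (row_part S z - ?C *v y) = 0"
    by (simp only: matrix_vector_mult_diff_distrib diff_self)
qed

lemma newton_Lambda_in: "newton_Lambda S B *v z \<in> reduced_tangent S B"
proof -
  obtain y where "newton_Lambda S B *v z = row_part S z - row_part S B *v y"
    and "transpose (row_part S B) *v (row_part S z - row_part S B *v y) = 0"
    by (rule newton_Lambda_mult_vec)
  then show ?thesis
    by (simp add: reduced_tangent_def coord_space_def row_part_matrix_vector_mult)
       (simp add: row_part_def)
qed

text \<open>The correction \<open>row_part S B *v y\<close> lies in the column space of
  \<open>row_part S B\<close>, to which \<open>h\<close> is orthogonal.\<close>

lemma inner_newton_Lambda:
  assumes h: "h \<in> reduced_tangent S B"
  shows "h \<bullet> (newton_Lambda S B *v z) = h \<bullet> z"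
proof -
  obtain y where y: "newton_Lambda S B *v z = row_part S z - row_part S B *v y"
    by (rule newton_Lambda_mult_vec)
  have "h \<bullet> (row_part S B *v y) = (transpose (row_part S B) *v h) \<bullet> y"
    by (simp add: dot_lmul_matrix[symmetric])
  then show ?thesis
    using h
    by (simp add: y inner_simps reduced_tangent_def inner_row_part row_part_eq_self)
qed

text \<open>Variational characterization of the projection: the difference of two candidates lies in
  the subspace and is orthogonal to it, hence to itself.\<close>

lemma newton_Lambda_eq_iff:
  "newton_Lambda S B *v z = p \<longleftrightarrow>
    p \<in> reduced_tangent S B \<and> (\<forall>h\<in>reduced_tangent S B. h \<bullet> (p - z) = 0)"
proof safe
  assume p: "p \<in> reduced_tangent S B" "\<forall>h\<in>reduced_tangent S B. h \<bullet> (p - z) = 0"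
  define q where "q = newton_Lambda S B *v z - p"
  have q: "q \<in> reduced_tangent S B"
    unfolding q_def using p(1) newton_Lambda_in by (intro subspace_diff subspace_reduced_tangent)
  have "q \<bullet> (newton_Lambda S B *v z - p) = 0"
    using p(2)[rule_format, OF q] by (simp add: inner_newton_Lambda[OF q] inner_diff_right)
  then show "newton_Lambda S B *v z = p"
    by (simp add: q_def)
qed (auto simp: newton_Lambda_in inner_newton_Lambda inner_diff_right)

text \<open>The equation says that \<open>u - v\<close> is the projection of
  \<open>u - t *\<^sub>R (A *v u)\<close>; the difference of these two vectors is
  \<open>t *\<^sub>R (A *v u) - v\<close>.\<close>

lemma newton_op_eq_iff:
  "newton_op S t B A *v u = - v \<longleftrightarrow>
    u - v \<in> reduced_tangent S B \<and> (\<forall>h\<in>reduced_tangent S B. h \<bullet> (t *\<^sub>R (A *v u) - v) = 0)"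
proof -
  have "newton_op S t B A *v u = - (u - newton_Lambda S B *v (u - t *\<^sub>R (A *v u)))"
    by (simp add: newton_op_def matrix_vector_mult_minus_left matrix_vector_mult_add_rdistrib
        matrix_vector_mult_diff_rdistrib scaleR_matrix_vector_assoc[symmetric]
        matrix_vector_mul_assoc[symmetric] matrix_vector_mult_diff_distrib
        matrix_vector_mult_scaleR)
  then have *: "newton_op S t B A *v u = - v \<longleftrightarrow>
      newton_Lambda S B *v (u - t *\<^sub>R (A *v u)) = u - v"
    by (simp only: neg_equal_iff_equal) (auto simp: algebra_simps)
  show ?thesis
    unfolding * newton_Lambda_eq_iff by (simp add: algebra_simps)
qed

lemma newton_op_bij:
  assumes "t \<noteq> 0" and pos: "sym_pos_def_over (block S S A) (reduced_tangent S B)"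
  shows "bij ((*v) (newton_op S t B A))"
proof -
  have "u = 0" if "newton_op S t B A *v u = 0" for u
  proof (rule ccontr)
    assume "u \<noteq> 0"
    \<comment> \<open>The homogeneous case \<open>v = 0\<close>; testing with \<open>h = u\<close>
      then gives \<open>u \<bullet> (A *v u) = 0\<close>.\<close>
    have "u \<in> reduced_tangent S B"
      and "\<forall>h\<in>reduced_tangent S B. h \<bullet> (t *\<^sub>R (A *v u)) = 0"
      using newton_op_eq_iff[of t A u 0] that by auto
    then have u: "u \<in> reduced_tangent S B" "u \<bullet> (A *v u) = 0"
      using \<open>t \<noteq> 0\<close> by auto
    \<comment> \<open>As \<open>u\<close> is supported in \<open>S\<close>, its quadratic form sees
      only the \<open>S\<close>-block of \<open>A\<close>.\<close>
    then have "u \<bullet> (block S S A *v u) = 0"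
      by (simp add: block_mult_vec inner_row_part row_part_eq_self reduced_tangent_def)
    moreover have "u \<bullet> (block S S A *v u) > 0"
      using pos u(1) \<open>u \<noteq> 0\<close> unfolding sym_pos_def_over_def by blast
    ultimately show False
      by simp
  qed
  then have "inj ((*v) (newton_op S t B A))"
    by (simp add: linear_injective_0)
  then show ?thesis
    by (simp add: bij_def linear_injective_imp_surjective)
qed

end

theorem corollary3p1:
  fixes M :: "(real^'n) set" and d :: nat
    and f :: "real^'n \<Rightarrow> real" and gradf :: "real^'n \<Rightarrow> real^'n" and hessf :: "real^'n \<Rightarrow> real^'n^'n"
    and \<mu> t :: real and x v :: "real^'n"
    and B :: "real^'c^'n" and lam :: "real^'c"
    and S :: "'n set" and A :: "real^'n^'n"
  assumes "compact M" and "embedded_submanifold d M" and "CARD('c) = CARD('n) - d"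
    and "\<And>y. GDERIV f y :> gradf y"
    and "\<And>y. (gradf has_derivative (\<lambda>h. hessf y *v h)) (at y)"
    and "continuous_on UNIV hessf"
    and "\<mu> > 0" and "t > 0" and "x \<in> M"
    and "transpose B ** B = mat 1" and "span (columns B) = normal_space_at M x"
    and "is_prox_grad_direction M f gradf \<mu> t x v"
    and "v = prox_l1 \<mu> t (x - t *\<^sub>R (gradf x + B *v lam)) - x" and "transpose B *v v = 0"
    and S: "S = nonzero_coords (x + v)"
    and A: "A = hessf x - weingarten_op M x B lam"
    and "rank (row_part S B) = CARD('c)"
    and "sym_pos_def_over (block S S A) (reduced_tangent S B)"
  shows "\<exists>w. (\<forall>w'. is_arg_min (\<lambda>w. ell S t A v \<bullet> w + 1/2 * (w \<bullet> (block S S A *v w)))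
                     (\<lambda>w. w \<in> reduced_tangent S B) w' \<longleftrightarrow> w' = w) \<and>
             (\<forall>u. newton_op S t B A *v u = - v \<longleftrightarrow>
                  u = stack S (row_part S v + w) (row_part (- S) v))"
proof -
  let ?L = "reduced_tangent S B" and ?N = "newton_op S t B A"
  note rank = \<open>rank (row_part S B) = CARD('c)\<close>
  note pos = \<open>sym_pos_def_over (block S S A) ?L\<close>
  have bij: "bij ((*v) ?N)"
    using newton_op_bij[OF rank _ pos] \<open>t > 0\<close> by simp
  then obtain u where u: "?N *v u = - v"
    by (metis bij_pointE)
  define w where "w = u - v"
  have w: "w \<in> ?L" and *: "\<forall>h\<in>?L. h \<bullet> (t *\<^sub>R (A *v u) - v) = 0"
    using u newton_op_eq_iff[OF rank] by (auto simp: w_def)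
  have "h \<bullet> (ell S t A v + block S S A *v w) = 0" if h: "h \<in> ?L" for h
  proof -
    have S: "h \<in> coord_space S" "w \<in> coord_space S"
      using h w by (auto simp: reduced_tangent_def)
    have "A *v u = A *v v + A *v w"
      by (simp add: w_def matrix_vector_mult_diff_distrib)
    \<comment> \<open>Scaled by \<open>t\<close>, \<open>ell\<close> contributes
      \<open>t *\<^sub>R (A *v v) - v\<close> and the block term
      \<open>t *\<^sub>R (A *v w)\<close>; they combine since \<open>u = v + w\<close>.\<close>
    then have "t * (h \<bullet> (ell S t A v + block S S A *v w)) = h \<bullet> (t *\<^sub>R (A *v u) - v)"
      using inner_ell[OF S(1), of t A v] S \<open>t > 0\<close>
      by (simp add: block_mult_vec inner_row_part row_part_eq_self inner_simps algebra_simps)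
    then show ?thesis
      using * h \<open>t > 0\<close> by simp
  qed
  then have "\<forall>w'. is_arg_min (\<lambda>w. ell S t A v \<bullet> w + 1/2 * (w \<bullet> (block S S A *v w)))
      (\<lambda>w. w \<in> ?L) w' \<longleftrightarrow> w' = w"
    using is_arg_min_quadratic_iff[OF subspace_reduced_tangent pos w] by blast
  \<comment> \<open>\<open>w\<close> vanishes outside \<open>S\<close>, so \<open>u\<close> and
    \<open>v\<close> share their hatted part.\<close>
  moreover have "stack S (row_part S v + w) (row_part (- S) v) = u"
    using w by (simp add: stack_row_part reduced_tangent_def w_def)
  moreover have "?N *v u' = - v \<longleftrightarrow> u' = u" for u'
    using bij u by (metis bij_pointE)
  ultimately show ?thesis
    by auto
qed

end
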